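(* For $i=1,2$, let $\mu_i$ be a probability measure on $\mathbb{R}^{n_i}$ and let $w_i:\mathbb{R}^{n_i}\to[0,\infty)$ be a measurable function such that the couple $(\mu_i,w_i)$ satisfies Property $(\tau)$ on $\mathbb{R}^{n_i}$. Define $w$ on $\mathbb{R}^{n_1}\times\mathbb{R}^{n_2}$ by $w(x_1,x_2)=w_1(x_1)+w_2(x_2)$. Then the couple $(\mu_1\otimes\mu_2,\,w)$ satisfies Property $(\tau)$ on $\mathbb{R}^{n_1}\times\mathbb{R}^{n_2}$.
   Context: Measures on $\mathbb{R}^n$ are Borel and "measurable" means Borel measurable; integrals are taken with respect to the completion of the measure (inf-convolutions of Borel functions are measurable for the completion). For functions $f,g$ on $\mathbb{R}^n$, the inf-convolution is $(f\,\square\, g)(x)=\inf\{f(x-y)+g(y): y\in\mathbb{R}^n\}$. Property $(\tau)$: if $\mu$ is a probability measure on $\mathbb{R}^n$ and $w\ge 0$ a measurable function on $\mathbb{R}^n$, the couple $(\mu,w)$ satisfies Property $(\tau)$ if for every bounded measurable function $\varphi:\mathbb{R}^n\to\mathbb{R}$, $$\Big(\int e^{\varphi\,\square\, w}\,d\mu\Big)\Big(\int e^{-\varphi}\,d\mu\Big)\le 1 .$$ *)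

theory Defs
  imports "HOL-Probability.Probability_Measure"
begin

text \<open>
  \<open>Inf\<close> on the reals is the true infimum only for nonempty sets that are bounded below. This holds
  wherever the notion is used below: for bounded \<open>f\<close> and real-valued \<open>g \<ge> 0\<close>, the function
  \<open>inf_conv f g\<close> lies between \<open>inf f\<close> and \<open>sup f + g 0\<close>.
\<close>

definition inf_conv :: "('a::group_add \<Rightarrow> real) \<Rightarrow> ('a \<Rightarrow> real) \<Rightarrow> 'a \<Rightarrow> real"
    (infixl \<open>\<box>\<close> 70)
  where "(f \<box> g) x = (INF y. f (x - y) + g y)"

text \<open>
  The inf-convolution of two Borel functions need not be Borel, but it is measurable for the completion
  of every Borel probability measure, so integrals are taken over \<^term>\<open>completion \<mu>\<close>;
  for such measurable nonnegative integrands \<^const>\<open>nn_integral\<close> is the usual Lebesgue integral.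
  The class \<^class>\<open>euclidean_space\<close> covers both \<open>real ^ 'n\<close> and products of such spaces.
\<close>

definition property_tau :: "'a::euclidean_space measure \<Rightarrow> ('a \<Rightarrow> real) \<Rightarrow> bool" where
  "property_tau \<mu> w \<longleftrightarrow>
     prob_space \<mu> \<and> sets \<mu> = sets borel \<and>
     w \<in> borel_measurable borel \<and> (\<forall>x. 0 \<le> w x) \<and>
     (\<forall>\<phi> :: 'a \<Rightarrow> real. \<phi> \<in> borel_measurable borel \<longrightarrow> bounded (range \<phi>) \<longrightarrow>
        (\<integral>\<^sup>+ x. ennreal (exp ((\<phi> \<box> w) x)) \<partial>completion \<mu>) *
        (\<integral>\<^sup>+ x. ennreal (exp (- \<phi> x)) \<partial>completion \<mu>) \<le> 1)"

end

theory Submission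
  imports Defs
begin

text \<open>
  Put \<open>\<psi>(x\<^sub>2) = - ln \<integral> exp(- \<phi>(x\<^sub>1, x\<^sub>2)) d\<mu>\<^sub>1(x\<^sub>1)\<close>. Choosing the second component of the inf-convolution
  variable first, \<open>(\<phi> \<box> w)(x\<^sub>1, x\<^sub>2) \<le> (\<phi>(\<cdot>, x\<^sub>2 - y\<^sub>2) \<box> w\<^sub>1)(x\<^sub>1) + w\<^sub>2(y\<^sub>2)\<close> for all \<open>y\<^sub>2\<close>. Property
  \<open>(\<tau>)\<close> for \<open>\<mu>\<^sub>1\<close> bounds the \<open>x\<^sub>1\<close>-integral of the exponential by \<open>exp(\<psi>(x\<^sub>2 - y\<^sub>2) + w\<^sub>2(y\<^sub>2))\<close>, hence by
  \<open>exp((\<psi> \<box> w\<^sub>2)(x\<^sub>2))\<close>, and Property \<open>(\<tau>)\<close> for \<open>\<mu>\<^sub>2\<close> applied to \<open>\<psi>\<close> concludes. Measurability of the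
  inf-convolutions is avoided: \<^const>\<open>nn_integral\<close> is a supremum over simple functions lying below the
  integrand, so Fubini is only ever applied to those.
\<close>

text \<open>The two bounds keep the values \<open>f (x - y) + g y\<close> bounded below, so that
  \<open>Inf\<close> on the reals is a true lower bound.\<close>

lemma inf_conv_le:
  assumes "\<And>x. - B \<le> f x" and "\<And>x. 0 \<le> g x"
  shows "(f \<box> g) x \<le> f (x - y) + g y"
  unfolding inf_conv_def
  by (rule cINF_lower) (auto intro!: bdd_belowI2[where m = "- B"] add_increasing2 assms)

lemma inf_conv_greatest:
  assumes "\<And>y. c \<le> f (x - y) + g y"
  shows "c \<le> (f \<box> g) x"
  unfolding inf_conv_def by (rule cINF_greatest) (auto intro: assms)

lemma inf_conv_prod_le:
  fixes \<phi> :: "'a::group_add \<times> 'b::group_add \<Rightarrow> real"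
  assumes "\<And>x. - B \<le> \<phi> x" and "\<And>x. 0 \<le> w1 x" and "\<And>x. 0 \<le> w2 x"
  shows "(\<phi> \<box> (\<lambda>(x1, x2). w1 x1 + w2 x2)) (x1, x2)
    \<le> ((\<lambda>z. \<phi> (z, x2 - y2)) \<box> w1) x1 + w2 y2"
proof -
  let ?w = "\<lambda>(x1, x2). w1 x1 + w2 x2"
  \<comment> \<open>With \<open>w2 y2\<close> moved to the left, the claim is a lower bound for an
    infimum over the first component alone.\<close>
  have "(\<phi> \<box> ?w) (x1, x2) - w2 y2 \<le> ((\<lambda>z. \<phi> (z, x2 - y2)) \<box> w1) x1"
  proof (rule inf_conv_greatest)
    fix y1
    show "(\<phi> \<box> ?w) (x1, x2) - w2 y2 \<le> \<phi> (x1 - y1, x2 - y2) + w1 y1"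
      using inf_conv_le[of B \<phi> ?w "(x1, x2)" "(y1, y2)"] assms by (auto split: prod.split)
  qed
  then show ?thesis by simp
qed

lemma ln_le_iff_le_exp: "0 < r \<Longrightarrow> ln r \<le> c \<longleftrightarrow> r \<le> exp c" for r c :: real
  by (metis exp_gt_zero ln_exp ln_le_cancel_iff)

text \<open>For finite positive \<open>a\<close>, \<open>ln a\<close> is a real lower bound of all
  \<open>f (x - y) + g y\<close>, hence of their infimum. The value 0 is trivial, and \<infinity>
  contradicts the hypothesis.\<close>

lemma le_exp_inf_conv:
  assumes "\<And>y. a \<le> ennreal (exp (f (x - y) + g y))"
  shows "a \<le> ennreal (exp ((f \<box> g) x))"
proof (cases a)
  case (real r)
  show ?thesis
  proof (cases "r = 0")
    case False
    with real have "0 < r" by simp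
    have "ln r \<le> (f \<box> g) x"
    proof (rule inf_conv_greatest)
      fix y
      have "r \<le> exp (f (x - y) + g y)" using assms[of y] real by simp
      then show "ln r \<le> f (x - y) + g y" using \<open>0 < r\<close> by (simp add: ln_le_iff_le_exp)
    qed
    then have "r \<le> exp ((f \<box> g) x)" using \<open>0 < r\<close> by (simp add: ln_le_iff_le_exp)
    then show ?thesis using real by (simp add: ennreal_leI)
  qed (use real in simp)
next
  case top
  then show ?thesis using assms[of 0] by (simp add: top_unique)
qed

text \<open>A substitute for Fubini when neither \<open>f\<close> nor \<open>g\<close> is known to
  be measurable. Each simple \<open>s\<close> below \<open>f\<close> has measurable sections, and
  these are the minorants \<open>h\<close> of the hypothesis.\<close>

lemma (in pair_sigma_finite) nn_integral_le_iterated: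
  assumes "\<And>h y. h \<in> borel_measurable M1 \<Longrightarrow> y \<in> space M2 \<Longrightarrow> (\<And>x. h x \<le> f (x, y))
    \<Longrightarrow> integral\<^sup>N M1 h \<le> g y"
  shows "integral\<^sup>N (M1 \<Otimes>\<^sub>M M2) f \<le> integral\<^sup>N M2 g"
  unfolding nn_integral_def[of "M1 \<Otimes>\<^sub>M M2"]
proof (rule SUP_least)
  fix s assume "s \<in> {s. simple_function (M1 \<Otimes>\<^sub>M M2) s \<and> s \<le> f}"
  then have s: "simple_function (M1 \<Otimes>\<^sub>M M2) s" and le: "\<And>x. s x \<le> f x"
    by (auto simp: le_fun_def)
  have m[measurable]: "s \<in> borel_measurable (M1 \<Otimes>\<^sub>M M2)"
    by (rule borel_measurable_simple_function[OF s])
  have "integral\<^sup>S (M1 \<Otimes>\<^sub>M M2) s = (\<integral>\<^sup>+ y. \<integral>\<^sup>+ x. s (x, y) \<partial>M1 \<partial>M2)"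
    by (simp add: nn_integral_eq_simple_integral[OF s, symmetric] nn_integral_snd[OF m])
  also have "\<dots> \<le> integral\<^sup>N M2 g"
    by (rule nn_integral_mono, rule assms) (auto intro: le)
  finally show "integral\<^sup>S (M1 \<Otimes>\<^sub>M M2) s \<le> integral\<^sup>N M2 g" .
qed

lemma ennreal_le_exp_if_mult_le_1:
  assumes "a * ennreal (exp (- c)) \<le> 1"
  shows "a \<le> ennreal (exp c)"
proof -
  have "a = a * ennreal (exp (- c)) * ennreal (exp c)"
    by (simp add: mult.assoc ennreal_mult[symmetric] exp_add[symmetric])
  also have "\<dots> \<le> 1 * ennreal (exp c)" by (rule mult_right_mono[OF assms]) simp
  finally show ?thesis by simp
qed

lemma property_tau_pair:
  fixes \<mu>1 :: "'a::euclidean_space measure" and \<mu>2 :: "'b::euclidean_space measure"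
  assumes "property_tau \<mu>1 w1" and "property_tau \<mu>2 w2"
  shows "property_tau (\<mu>1 \<Otimes>\<^sub>M \<mu>2) (\<lambda>(x1, x2). w1 x1 + w2 x2)"
proof -
  have p1: "prob_space \<mu>1" and p2: "prob_space \<mu>2"
    and s1[measurable_cong]: "sets \<mu>1 = sets borel" and s2[measurable_cong]: "sets \<mu>2 = sets borel"
    and w1[measurable]: "w1 \<in> borel_measurable borel"
    and w2[measurable]: "w2 \<in> borel_measurable borel"
    and w1_nonneg: "\<And>x. 0 \<le> w1 x" and w2_nonneg: "\<And>x. 0 \<le> w2 x"
    and tau1: "\<And>f. f \<in> borel_measurable borel \<Longrightarrow> bounded (range f) \<Longrightarrow>
      (\<integral>\<^sup>+ x. ennreal (exp ((f \<box> w1) x)) \<partial>\<mu>1) * (\<integral>\<^sup>+ x. ennreal (exp (- f x)) \<partial>\<mu>1) \<le> 1"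
    and tau2: "\<And>f. f \<in> borel_measurable borel \<Longrightarrow> bounded (range f) \<Longrightarrow>
      (\<integral>\<^sup>+ x. ennreal (exp ((f \<box> w2) x)) \<partial>\<mu>2) * (\<integral>\<^sup>+ x. ennreal (exp (- f x)) \<partial>\<mu>2) \<le> 1"
    using assms unfolding property_tau_def nn_integral_completion by auto
  interpret P1: prob_space \<mu>1 by fact
  interpret P2: prob_space \<mu>2 by fact
  interpret P: pair_prob_space \<mu>1 \<mu>2 ..
  have space1[simp]: "space \<mu>1 = UNIV" using sets_eq_imp_space_eq[OF s1] by simp
  have sets12: "sets (\<mu>1 \<Otimes>\<^sub>M \<mu>2) = sets borel"
    using sets_pair_measure_cong[OF s1 s2] unfolding borel_prod .
  let ?w = "\<lambda>(x1, x2). w1 x1 + w2 x2"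
  have w_measurable: "?w \<in> borel_measurable borel"
    unfolding borel_prod[symmetric] by measurable
  have "(\<integral>\<^sup>+ x. ennreal (exp ((\<phi> \<box> ?w) x)) \<partial>(\<mu>1 \<Otimes>\<^sub>M \<mu>2)) *
      (\<integral>\<^sup>+ x. ennreal (exp (- \<phi> x)) \<partial>(\<mu>1 \<Otimes>\<^sub>M \<mu>2)) \<le> 1"
    if \<phi>: "\<phi> \<in> borel_measurable borel" and bdd: "bounded (range \<phi>)" for \<phi> :: "'a \<times> 'b \<Rightarrow> real"
  proof -
    obtain B where B: "\<And>x. \<bar>\<phi> x\<bar> \<le> B" using bdd by (auto simp: bounded_iff)
    have \<phi>_ge: "- B \<le> \<phi> x" and \<phi>_le: "\<phi> x \<le> B" for x
      using B[of x] by auto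
    have \<phi>_pair[measurable]: "\<phi> \<in> borel_measurable (borel \<Otimes>\<^sub>M borel)"
      using \<phi> by (simp add: borel_prod)
    define I where "I x2 = (\<integral>\<^sup>+ x1. ennreal (exp (- \<phi> (x1, x2))) \<partial>\<mu>1)" for x2
    define \<psi> where "\<psi> x2 = - ln (enn2real (I x2))" for x2
    \<comment> \<open>Since \<open>I\<close> takes values between \<open>exp (- B)\<close> and
      \<open>exp B\<close>, neither \<open>enn2real\<close> nor \<open>ln\<close> meets a default
      value in \<open>\<psi>\<close>, and \<open>\<psi>\<close> is bounded by \<open>B\<close>, as
      Property (\<tau>) for \<open>\<mu>2\<close> requires.\<close>
    have I_le: "I x2 \<le> ennreal (exp B)" for x2
    proof -
      have "I x2 \<le> (\<integral>\<^sup>+ x1. ennreal (exp B) \<partial>\<mu>1)"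
        unfolding I_def using \<phi>_ge by (intro nn_integral_mono ennreal_leI) (simp add: minus_le_iff)
      then show ?thesis using P1.emeasure_space_1 by simp
    qed
    have I_ge: "ennreal (exp (- B)) \<le> I x2" for x2
    proof -
      have "(\<integral>\<^sup>+ x1. ennreal (exp (- B)) \<partial>\<mu>1) \<le> I x2"
        unfolding I_def using \<phi>_le by (intro nn_integral_mono ennreal_leI) simp
      then show ?thesis using P1.emeasure_space_1 by simp
    qed
    have I_measurable[measurable]: "I \<in> borel_measurable borel"
      unfolding I_def by measurable
    have \<psi>_measurable: "\<psi> \<in> borel_measurable borel"
      unfolding \<psi>_def by measurable
    have I_real: "\<exists>r. I x2 = ennreal r \<and> exp (- B) \<le> r \<and> r \<le> exp B" for x2
      using I_le[of x2] I_ge[of x2] by (cases "I x2") (auto simp: top_unique)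
    have exp_\<psi>: "ennreal (exp (- \<psi> x2)) = I x2" and \<psi>_abs: "\<bar>\<psi> x2\<bar> \<le> B" for x2
    proof -
      obtain r where r: "I x2 = ennreal r" "exp (- B) \<le> r" "r \<le> exp B"
        using I_real by blast
      have "0 < r" using r(2) exp_gt_zero[of "- B"] by linarith
      then have \<psi>_eq: "\<psi> x2 = - ln r" using r by (simp add: \<psi>_def)
      then show "ennreal (exp (- \<psi> x2)) = I x2" using r \<open>0 < r\<close> by simp
      have "- B \<le> ln r" "ln r \<le> B"
        using r \<open>0 < r\<close> by (simp_all add: ln_ge_iff ln_le_iff_le_exp)
      then show "\<bar>\<psi> x2\<bar> \<le> B" using \<psi>_eq by simp
    qed
    have \<psi>_bounded: "bounded (range \<psi>)"
      using \<psi>_abs by (auto simp: bounded_iff)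

    have slice_le: "(\<integral>\<^sup>+ x1. ennreal (exp (((\<lambda>z. \<phi> (z, t)) \<box> w1) x1)) \<partial>\<mu>1) \<le> ennreal (exp (\<psi> t))"
      for t
    proof (rule ennreal_le_exp_if_mult_le_1)
      have "(\<lambda>z. \<phi> (z, t)) \<in> borel_measurable borel" by measurable
      moreover have "bounded (range (\<lambda>z. \<phi> (z, t)))"
        using B by (auto simp: bounded_iff)
      ultimately show "(\<integral>\<^sup>+ x1. ennreal (exp (((\<lambda>z. \<phi> (z, t)) \<box> w1) x1)) \<partial>\<mu>1)
          * ennreal (exp (- \<psi> t)) \<le> 1"
        unfolding exp_\<psi> I_def by (rule tau1)
    qed

    have "(\<integral>\<^sup>+ x. ennreal (exp ((\<phi> \<box> ?w) x)) \<partial>(\<mu>1 \<Otimes>\<^sub>M \<mu>2))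
        \<le> (\<integral>\<^sup>+ x2. ennreal (exp ((\<psi> \<box> w2) x2)) \<partial>\<mu>2)"
    proof (rule P.nn_integral_le_iterated, rule le_exp_inf_conv)
      fix h x2 y2
      assume h[measurable]: "h \<in> borel_measurable \<mu>1"
        and h_le: "\<And>x1. h x1 \<le> ennreal (exp ((\<phi> \<box> ?w) (x1, x2)))"
      let ?f = "\<lambda>z. \<phi> (z, x2 - y2)"
      \<comment> \<open>The factor \<open>exp (w2 y2)\<close> is carried to the side of the
        measurable \<open>h\<close>, where it can be pulled out of the integral; the inf-convolution
        on the right is only compared by monotonicity. As \<open>y2\<close> is arbitrary, the
        infimum over it can be taken at the end.\<close>
      have "h x1 * ennreal (exp (- w2 y2)) \<le> ennreal (exp ((?f \<box> w1) x1))" for x1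
      proof -
        have "h x1 \<le> ennreal (exp ((?f \<box> w1) x1 + w2 y2))"
          using inf_conv_prod_le[of B \<phi> w1 w2 x1 x2 y2] \<phi>_ge w1_nonneg w2_nonneg
          by (intro order_trans[OF h_le] ennreal_leI) simp
        then have "h x1 * ennreal (exp (- w2 y2))
            \<le> ennreal (exp ((?f \<box> w1) x1 + w2 y2)) * ennreal (exp (- w2 y2))"
          by (rule mult_right_mono) simp
        then show ?thesis
          by (simp add: ennreal_mult[symmetric] exp_add[symmetric])
      qed
      then have "(\<integral>\<^sup>+ x1. h x1 * ennreal (exp (- w2 y2)) \<partial>\<mu>1) \<le> ennreal (exp (\<psi> (x2 - y2)))"
        by (intro order_trans[OF nn_integral_mono slice_le])
      then have "integral\<^sup>N \<mu>1 h * ennreal (exp (- w2 y2)) \<le> ennreal (exp (\<psi> (x2 - y2)))"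
        by (simp add: nn_integral_multc)
      then have "integral\<^sup>N \<mu>1 h * ennreal (exp (- w2 y2)) * ennreal (exp (w2 y2))
          \<le> ennreal (exp (\<psi> (x2 - y2))) * ennreal (exp (w2 y2))"
        by (rule mult_right_mono) simp
      then show "integral\<^sup>N \<mu>1 h \<le> ennreal (exp (\<psi> (x2 - y2) + w2 y2))"
        by (simp add: mult.assoc ennreal_mult[symmetric] exp_add[symmetric])
    qed
    \<comment> \<open>Here the integrand is Borel, so Tonelli applies directly and gives an
      equality.\<close>
    moreover have "(\<integral>\<^sup>+ x. ennreal (exp (- \<phi> x)) \<partial>(\<mu>1 \<Otimes>\<^sub>M \<mu>2))
        = (\<integral>\<^sup>+ x2. ennreal (exp (- \<psi> x2)) \<partial>\<mu>2)"
      unfolding exp_\<psi> I_def by (subst P.nn_integral_snd) simp_all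
    ultimately show ?thesis
      using order_trans[OF mult_right_mono tau2[OF \<psi>_measurable \<psi>_bounded]] by simp
  qed
  then show ?thesis
    unfolding property_tau_def nn_integral_completion
    using P.prob_space_axioms sets12 w_measurable w1_nonneg w2_nonneg by (auto simp: add_nonneg_nonneg)
qed

theorem lemma1:
  fixes \<mu>1 :: "(real ^ 'n1) measure" and \<mu>2 :: "(real ^ 'n2) measure"
    and w1 :: "real ^ 'n1 \<Rightarrow> real" and w2 :: "real ^ 'n2 \<Rightarrow> real"
  assumes "property_tau \<mu>1 w1"
    and "property_tau \<mu>2 w2"
  shows "property_tau (\<mu>1 \<Otimes>\<^sub>M \<mu>2) (\<lambda>(x1, x2). w1 x1 + w2 x2)"
  using assms by (rule property_tau_pair)

end
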